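(* Let $G=(V,E)$ be a finite connected multigraph without self-loops and with at least one edge. Let $\mathcal{H}$ be the set of all vertex-induced, connected subgraphs of $G$ that contain at least one edge, and suppose $H\in\mathcal{H}$ satisfies $\theta(H)=\max_{H'\in\mathcal{H}}\theta(H')$. Then $H$ is a homogeneous core of $G$.
   Context: For a graph $G=(V,E)$ with at least two vertices, the denseness is $\theta(G)=\frac{|E|}{|V|-1}$. For a finite connected multigraph $G$, $\Gamma_G$ is the set of spanning trees (as edge subsets), $\mathcal{P}(\Gamma_G)$ the set of probability mass functions (pmfs) on it. A pmf is optimal if it minimizes $\sum_{\gamma,\gamma'\in\Gamma_G}|\gamma\cap\gamma'|\,\mu(\gamma)\mu(\gamma')$ over $\mathcal{P}(\Gamma_G)$. The edge usage probabilities $\eta^*(e)=\sum_{\gamma\ni e}\mu^*(\gamma)$ are the same for all optimal $\mu^*$; $G$ is homogeneous if $\eta^*$ is constant. A spanning tree is fair if it has positive mass under some optimal pmf. A homogeneous core of $G$ is a connected subgraph $H=(V_H,E_H)$ which (1) has at least one edge, (2) satisfies that $\gamma\cap E_H$ is a spanning tree of $H$ for every fair tree $\gamma$ of $G$, (3) is vertex-induced (contains every edge of $G$ with both endpoints in $V_H$), and (4) is itself a homogeneous graph. *)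

theory Defs
  imports "HOL-Probability.Probability_Mass_Function"
begin

text \<open>
  An undirected multigraph: \<open>ends G e\<close> is the set of endpoints of the edge \<open>e\<close>, a singleton
  exactly when \<open>e\<close> is a self-loop. Parallel edges are distinct edges with equal endpoint sets.
  The values of \<open>ends G\<close> outside \<open>edges G\<close> are irrelevant.
\<close>

record ('v, 'e) mgraph =
  verts :: "'v set"
  edges :: "'e set"
  ends :: "'e \<Rightarrow> 'v set"

definition finite_mgraph :: "('v, 'e) mgraph \<Rightarrow> bool" where
  "finite_mgraph G \<longleftrightarrow> finite (verts G) \<and> finite (edges G) \<and>
     (\<forall>e\<in>edges G. ends G e \<subseteq> verts G \<and> card (ends G e) \<in> {1, 2})"

definition loopless :: "('v, 'e) mgraph \<Rightarrow> bool" where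
  "loopless G \<longleftrightarrow> (\<forall>e\<in>edges G. card (ends G e) \<noteq> 1)"

definition adj :: "('v, 'e) mgraph \<Rightarrow> ('v \<times> 'v) set" where
  "adj G = {(u, v). \<exists>e\<in>edges G. ends G e = {u, v}}"

definition mconnected :: "('v, 'e) mgraph \<Rightarrow> bool" where
  "mconnected G \<longleftrightarrow> verts G \<noteq> {} \<and> (\<forall>u\<in>verts G. \<forall>v\<in>verts G. (u, v) \<in> (adj G)\<^sup>*)"

text \<open>
  A cycle is given by its vertices and edges in cyclic order, \<open>es ! i\<close> joining \<open>vs ! i\<close> to its
  successor. Length 1 is a self-loop, length 2 a pair of parallel edges.
\<close>

definition is_cycle :: "('v, 'e) mgraph \<Rightarrow> 'v list \<Rightarrow> 'e list \<Rightarrow> bool" where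
  "is_cycle G vs es \<longleftrightarrow> es \<noteq> [] \<and> length vs = length es \<and> distinct vs \<and> distinct es \<and>
     set vs \<subseteq> verts G \<and> set es \<subseteq> edges G \<and>
     (\<forall>i<length es. ends G (es ! i) = {vs ! i, vs ! (Suc i mod length vs)})"

definition is_tree :: "('v, 'e) mgraph \<Rightarrow> bool" where
  "is_tree G \<longleftrightarrow> mconnected G \<and> (\<nexists>vs es. is_cycle G vs es)"

definition spanning_trees :: "('v, 'e) mgraph \<Rightarrow> 'e set set" where
  "spanning_trees G = {T. T \<subseteq> edges G \<and> is_tree (G\<lparr>edges := T\<rparr>)}"

text \<open>Pmfs on the spanning trees are pmfs on edge sets supported on \<open>spanning_trees G\<close>.\<close>

definition tree_pmfs :: "('v, 'e) mgraph \<Rightarrow> 'e set pmf set" where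
  "tree_pmfs G = {\<mu>. set_pmf \<mu> \<subseteq> spanning_trees G}"

definition expected_overlap :: "('v, 'e) mgraph \<Rightarrow> 'e set pmf \<Rightarrow> real" where
  "expected_overlap G \<mu> =
     (\<Sum>\<gamma>\<in>spanning_trees G. \<Sum>\<gamma>'\<in>spanning_trees G. real (card (\<gamma> \<inter> \<gamma>')) * pmf \<mu> \<gamma> * pmf \<mu> \<gamma>')"

definition optimal_pmf :: "('v, 'e) mgraph \<Rightarrow> 'e set pmf \<Rightarrow> bool" where
  "optimal_pmf G \<mu> \<longleftrightarrow> \<mu> \<in> tree_pmfs G \<and>
     (\<forall>\<nu>\<in>tree_pmfs G. expected_overlap G \<mu> \<le> expected_overlap G \<nu>)"

definition edge_usage :: "('v, 'e) mgraph \<Rightarrow> 'e set pmf \<Rightarrow> 'e \<Rightarrow> real" where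
  "edge_usage G \<mu> e = (\<Sum>\<gamma> | \<gamma> \<in> spanning_trees G \<and> e \<in> \<gamma>. pmf \<mu> \<gamma>)"

text \<open>
  For a finite connected multigraph the description below is proper: an optimal pmf exists by
  compactness, and since the expected overlap of \<open>\<mu>\<close> is the sum over all edges \<open>e\<close> of
  \<open>(edge_usage G \<mu> e)\<^sup>2\<close>, strict convexity makes all optimal pmfs have the same edge usage.
\<close>

definition opt_edge_usage :: "('v, 'e) mgraph \<Rightarrow> 'e \<Rightarrow> real" where
  "opt_edge_usage G e = (THE x. \<exists>\<mu>. optimal_pmf G \<mu> \<and> x = edge_usage G \<mu> e)"

definition homogeneous :: "('v, 'e) mgraph \<Rightarrow> bool" where
  "homogeneous G \<longleftrightarrow> (\<exists>c. \<forall>e\<in>edges G. opt_edge_usage G e = c)"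

definition fair_tree :: "('v, 'e) mgraph \<Rightarrow> 'e set \<Rightarrow> bool" where
  "fair_tree G \<gamma> \<longleftrightarrow> \<gamma> \<in> spanning_trees G \<and> (\<exists>\<mu>. optimal_pmf G \<mu> \<and> pmf \<mu> \<gamma> > 0)"

text \<open>
  A subgraph inherits the whole function \<open>ends\<close>, so it is determined by its vertices and edges
  and a finite graph has only finitely many subgraphs.
\<close>

definition subgraph :: "('v, 'e) mgraph \<Rightarrow> ('v, 'e) mgraph \<Rightarrow> bool" where
  "subgraph H G \<longleftrightarrow> verts H \<subseteq> verts G \<and> edges H \<subseteq> edges G \<and> ends H = ends G \<and>
     (\<forall>e\<in>edges H. ends H e \<subseteq> verts H)"

definition vertex_induced :: "('v, 'e) mgraph \<Rightarrow> ('v, 'e) mgraph \<Rightarrow> bool" where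
  "vertex_induced H G \<longleftrightarrow> subgraph H G \<and> (\<forall>e\<in>edges G. ends G e \<subseteq> verts H \<longrightarrow> e \<in> edges H)"

definition homogeneous_core :: "('v, 'e) mgraph \<Rightarrow> ('v, 'e) mgraph \<Rightarrow> bool" where
  "homogeneous_core H G \<longleftrightarrow> subgraph H G \<and> mconnected H \<and> edges H \<noteq> {} \<and>
     (\<forall>\<gamma>. fair_tree G \<gamma> \<longrightarrow> \<gamma> \<inter> edges H \<in> spanning_trees H) \<and>
     vertex_induced H G \<and> homogeneous H"

definition denseness :: "('v, 'e) mgraph \<Rightarrow> real" where
  "denseness G = real (card (edges G)) / (real (card (verts G)) - 1)"

definition induced_connected_subgraphs :: "('v, 'e) mgraph \<Rightarrow> ('v, 'e) mgraph set" where
  "induced_connected_subgraphs G = {H. vertex_induced H G \<and> mconnected H \<and> edges H \<noteq> {}}"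

end

theory Submission
  imports Defs
begin

text \<open>
  The proof compares the optimal edge usage \<open>\<eta>\<close> of \<open>G\<close> with the inverse of the maximal denseness \<open>\<theta>\<close>.
  It rests on one inequality, \<open>\<eta> e \<ge> 1 / \<theta>\<close> for every edge \<open>e\<close> (\<open>edge_usage_lower_bound\<close>).

  To see the inequality, note that the expected overlap is \<open>\<Sum>e. (\<eta> e)\<^sup>2\<close>, so its first-order optimality
  condition says that fair trees have least total weight when the edges are weighted by \<open>\<eta>\<close> itself.
  Let \<open>a\<close> be the least usage and \<open>F\<close> the set of edges of usage \<open>a\<close>. As in Kruskal's algorithm, an
  exchange of edges shows that a tree of least weight connects, by its own edges in \<open>F\<close>, whatever \<open>F\<close>
  connects. Let \<open>C\<close> be the vertex set of a component of \<open>F\<close> that contains an edge, and let \<open>E\<^sub>C\<close> be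
  the set of edges of \<open>F\<close> inside \<open>C\<close>. Every fair tree then has at least \<open>|C| - 1\<close> edges in \<open>E\<^sub>C\<close>, and
  taking expectations gives \<open>|C| - 1 \<le> a |E\<^sub>C|\<close>. The subgraph induced on \<open>C\<close> is connected and contains
  \<open>E\<^sub>C\<close>, so \<open>|E\<^sub>C| \<le> \<theta> (|C| - 1)\<close>. Hence \<open>a \<theta> \<ge> 1\<close>.

  Now let \<open>H\<close> have denseness \<open>\<theta>\<close>. Summing the inequality over the edges of \<open>H\<close>, the expected
  number of edges of \<open>H\<close> in a random tree is at least \<open>|E\<^sub>H| / \<theta> = |V\<^sub>H| - 1\<close>. No tree has more than
  \<open>|V\<^sub>H| - 1\<close> edges in \<open>H\<close>, so every fair tree has exactly that many, which makes its trace a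
  spanning tree of \<open>H\<close> (\<open>fair_tree_spans_densest\<close>). Induced connected subgraphs of \<open>H\<close> are induced in
  \<open>G\<close>, so \<open>H\<close> is densest also within itself. Apply the inequality to \<open>H\<close> in place of \<open>G\<close>: the usages
  in \<open>H\<close> sum to \<open>|V\<^sub>H| - 1\<close> and are all at least \<open>1 / \<theta>\<close>, hence all equal to \<open>1 / \<theta>\<close>
  (\<open>homogeneous_if_densest\<close>).
\<close>

section \<open>Connectivity by a set of edges\<close>

text \<open>
  The incidence function \<open>r\<close> and the edge set are separate parameters because the proofs below
  delete and exchange edges while the incidences stay fixed.
\<close>

definition reach :: "('e \<Rightarrow> 'v set) \<Rightarrow> 'e set \<Rightarrow> ('v \<times> 'v) set" where
  "reach r X = {(u, v). \<exists>e\<in>X. r e = {u, v}}\<^sup>*"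

lemma adj_rtrancl: "(adj G)\<^sup>* = reach (ends G) (edges G)"
  by (simp add: adj_def reach_def)

lemma mconnected_iff_reach:
  "mconnected G \<longleftrightarrow> verts G \<noteq> {} \<and> verts G \<times> verts G \<subseteq> reach (ends G) (edges G)"
  by (auto simp: mconnected_def adj_rtrancl)

lemma equiv_reach: "equiv UNIV (reach r X)"
proof -
  have "sym {(u, v). \<exists>e\<in>X. r e = {u, v}}"
    by (auto simp: sym_def insert_commute)
  then show ?thesis
    unfolding reach_def by (intro equivI refl_rtrancl trans_rtrancl sym_rtrancl) auto
qed

lemma reach_refl [simp]: "(u, u) \<in> reach r X"
  by (simp add: reach_def)

lemma reach_sym: "(u, v) \<in> reach r X \<Longrightarrow> (v, u) \<in> reach r X"
  using equiv_reach by (metis equivE symD)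

lemma reach_trans: "(u, v) \<in> reach r X \<Longrightarrow> (v, w) \<in> reach r X \<Longrightarrow> (u, w) \<in> reach r X"
  unfolding reach_def by (rule rtrancl_trans)

lemma reach_edge: "e \<in> X \<Longrightarrow> r e = {u, v} \<Longrightarrow> (u, v) \<in> reach r X"
  unfolding reach_def by (rule r_into_rtrancl) auto

lemma reach_least:
  assumes "\<And>e u v. e \<in> X \<Longrightarrow> r e = {u, v} \<Longrightarrow> (u, v) \<in> reach r Y"
  shows "reach r X \<subseteq> reach r Y"
proof -
  have "{(u, v). \<exists>e\<in>X. r e = {u, v}} \<subseteq> reach r Y"
    using assms by auto
  then have "{(u, v). \<exists>e\<in>X. r e = {u, v}}\<^sup>* \<subseteq> (reach r Y)\<^sup>*"
    by (rule rtrancl_mono)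
  then show ?thesis
    by (simp add: reach_def)
qed

lemma reach_mono: "X \<subseteq> Y \<Longrightarrow> reach r X \<subseteq> reach r Y"
  by (rule reach_least) (auto intro: reach_edge)

lemma reach_insert:
  assumes "r e = {x, y}"
  shows "(u, v) \<in> reach r (insert e X) \<longleftrightarrow> (u, v) \<in> reach r X \<or>
    (u, x) \<in> reach r X \<and> (y, v) \<in> reach r X \<or> (u, y) \<in> reach r X \<and> (x, v) \<in> reach r X"
    (is "_ \<longleftrightarrow> ?R u v")
proof
  have "{(u, v). \<exists>e'\<in>insert e X. r e' = {u, v}} =
      insert (x, y) (insert (y, x) {(u, v). \<exists>e\<in>X. r e = {u, v}})"
    using assms by (auto simp: doubleton_eq_iff)
  then have eq: "reach r (insert e X) =
      (insert (x, y) (insert (y, x) {(u, v). \<exists>e\<in>X. r e = {u, v}}))\<^sup>*"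
    by (simp add: reach_def)
  assume "(u, v) \<in> reach r (insert e X)"
  then show "?R u v"
    unfolding eq rtrancl_insert reach_def[symmetric]
    by (simp, meson reach_trans reach_sym)
next
  have e: "(x, y) \<in> reach r (insert e X)" "(y, x) \<in> reach r (insert e X)"
    using assms by (auto intro!: reach_edge reach_sym[of x y])
  assume "?R u v"
  then show "(u, v) \<in> reach r (insert e X)"
    using e reach_mono[of X "insert e X" r] by (meson reach_trans subsetD subset_insertI)
qed

lemma reach_insert_redundant:
  assumes "r e = {x, y}" "(x, y) \<in> reach r X"
  shows "reach r (insert e X) = reach r X"
proof -
  have "(u, v) \<in> reach r (insert e X) \<longleftrightarrow> (u, v) \<in> reach r X" for u v
    unfolding reach_insert[of r e x y, OF assms(1)] using assms(2) by (meson reach_trans reach_sym)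
  then show ?thesis by auto
qed

text \<open>
  A walk never leaves the component of its starting point, so it survives deletion of all edges
  outside that component.
\<close>

lemma reach_within_component:
  assumes "(u, v) \<in> reach r X"
  shows "(u, v) \<in> reach r {e \<in> X. r e \<subseteq> reach r X `` {u}}"
  using assms[unfolded reach_def]
proof (induction rule: rtrancl_induct)
  case base
  show ?case by simp
next
  case (step v w)
  then obtain e where e: "e \<in> X" "r e = {v, w}" by auto
  have "(u, v) \<in> reach r X" using step(1) by (simp add: reach_def)
  then have "(u, v) \<in> reach r X" "(u, w) \<in> reach r X"
    using e by (auto intro: reach_trans reach_edge)
  then have "(v, w) \<in> reach r {e \<in> X. r e \<subseteq> reach r X `` {u}}"
    using e by (intro reach_edge[of e]) auto
  then show ?case
    using step.IH by (rule reach_trans[rotated])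
qed

section \<open>Counting components\<close>

definition edges_on :: "'v set \<Rightarrow> ('e \<Rightarrow> 'v set) \<Rightarrow> 'e set \<Rightarrow> bool" where
  "edges_on V r X \<longleftrightarrow> finite X \<and> (\<forall>e\<in>X. \<exists>x\<in>V. \<exists>y\<in>V. r e = {x, y})"

lemma edges_on_within:
  assumes "edges_on V r X" "\<And>e. e \<in> X \<Longrightarrow> r e \<subseteq> C"
  shows "edges_on C r X"
  unfolding edges_on_def
proof (intro conjI ballI)
  show "finite X" using assms(1) by (simp add: edges_on_def)
  fix e assume e: "e \<in> X"
  then obtain x y where xy: "r e = {x, y}" using assms(1) by (auto simp: edges_on_def)
  then have "x \<in> C" "y \<in> C" using assms(2)[OF e] by simp_all
  with xy show "\<exists>x\<in>C. \<exists>y\<in>C. r e = {x, y}" by (intro bexI)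
qed

text \<open>
  The classes \<open>V // reach r X\<close> are the components of the graph on \<open>V\<close> with edge set \<open>X\<close>. If a new edge
  joins two of them, these two are replaced by their union and the others are unchanged.
\<close>

lemma card_components_insert:
  assumes V: "finite V" "x \<in> V" "y \<in> V" and e: "r e = {x, y}"
  shows "card (V // reach r X) =
    card (V // reach r (insert e X)) + (if (x, y) \<in> reach r X then 0 else 1)"
proof (cases "(x, y) \<in> reach r X")
  case True
  then show ?thesis by (simp add: reach_insert_redundant[of r e x y, OF e])
next
  case False
  let ?C = "\<lambda>v. reach r X `` {v}"
  let ?D = "\<lambda>v. reach r (insert e X) `` {v}"
  let ?M = "?C x \<union> ?C y"
  have D: "?D v = (if v \<in> ?M then ?M else ?C v)" for v
  proof (rule set_eqI)
    fix w
    show "w \<in> ?D v \<longleftrightarrow> w \<in> (if v \<in> ?M then ?M else ?C v)"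
      unfolding Image_singleton_iff reach_insert[of r e x y, OF e]
      by (cases "v \<in> ?M") (auto, (meson reach_trans reach_sym)+)
  qed
  have Ceq: "?C v = ?C w \<longleftrightarrow> (v, w) \<in> reach r X" for v w
    using equiv_class_eq_iff[OF equiv_reach, of v w r X] by simp
  have eqC: "V // reach r X = ?C ` V" and eqD: "V // reach r (insert e X) = ?D ` V"
    by (auto simp: quotient_def)
  have M: "?D ` V = insert ?M (?C ` V - {?C x, ?C y})"
  proof
    show "?D ` V \<subseteq> insert ?M (?C ` V - {?C x, ?C y})"
      using Ceq by (auto simp: D)
    have "?D x = ?M" using D[of x] by simp
    moreover have "?C v \<in> ?D ` V" if "v \<in> V" "?C v \<noteq> ?C x" "?C v \<noteq> ?C y" for v
    proof -
      have "v \<notin> ?M" using that Ceq by blast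
      then have "?D v = ?C v" by (simp add: D)
      then show ?thesis using that(1) by blast
    qed
    ultimately show "insert ?M (?C ` V - {?C x, ?C y}) \<subseteq> ?D ` V"
      using V(2) by blast
  qed
  have "?M \<notin> ?C ` V - {?C x, ?C y}"
  proof
    assume "?M \<in> ?C ` V - {?C x, ?C y}"
    then obtain v where v: "?M = ?C v" by auto
    have "x \<in> ?M" "y \<in> ?M" by auto
    then have "(v, x) \<in> reach r X" "(v, y) \<in> reach r X" unfolding v by auto
    then show False using False by (meson reach_trans reach_sym)
  qed
  moreover have "?C x \<noteq> ?C y" using False Ceq by blast
  moreover have "card (?C ` V) = card (?C ` V - {?C x, ?C y}) + card {?C x, ?C y}"
  proof -
    have "{?C x, ?C y} \<subseteq> ?C ` V" using V by blast
    moreover from this have "card {?C x, ?C y} \<le> card (?C ` V)"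
      using V(1) by (intro card_mono) auto
    ultimately show ?thesis by (simp add: card_Diff_subset)
  qed
  ultimately show ?thesis
    using False V(1) by (simp add: eqC eqD M)
qed

lemma card_components_empty: "card (V // reach r {}) = card V"
proof -
  have "V // reach r {} = (\<lambda>v. {v}) ` V"
    by (auto simp: quotient_def reach_def)
  then show ?thesis
    by (simp add: card_image)
qed

text \<open>
  Each added edge lowers the number of components, initially \<open>|V|\<close>, by at most one.
\<close>

lemma card_le_components_plus_edges:
  assumes "finite V" "edges_on V r X"
  shows "card V \<le> card (V // reach r X) + card X"
proof -
  have "finite X" using assms(2) by (simp add: edges_on_def)
  then show ?thesis using assms(2)
  proof (induction X)
    case empty
    show ?case by (simp add: card_components_empty)
  next
    case (insert e X)
    then obtain x y where "x \<in> V" "y \<in> V" "r e = {x, y}"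
      by (auto simp: edges_on_def)
    from card_components_insert[where X = X and r = r, OF assms(1) this] insert show ?case
      by (auto simp: edges_on_def split: if_splits)
  qed
qed

text \<open>
  Acyclicity as independence in the graphic matroid: every edge is a bridge. Unlike the absence of
  cyclic lists, this form fits induction on the edge set.
\<close>

definition forest :: "('e \<Rightarrow> 'v set) \<Rightarrow> 'e set \<Rightarrow> bool" where
  "forest r X \<longleftrightarrow> (\<forall>e\<in>X. \<forall>x y. r e = {x, y} \<longrightarrow> (x, y) \<notin> reach r (X - {e}))"

lemma forest_subset: "forest r X \<Longrightarrow> Y \<subseteq> X \<Longrightarrow> forest r Y"
  unfolding forest_def using reach_mono[OF Diff_mono[OF _ subset_refl]] by (meson subsetD)

text \<open>
  In a forest every added edge joins two components, so the count of
  \<open>card_le_components_plus_edges\<close> is exact.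
\<close>

lemma forest_card_components:
  assumes "finite V" "edges_on V r X" "forest r X"
  shows "card V = card (V // reach r X) + card X"
proof -
  have "finite X" using assms(2) by (simp add: edges_on_def)
  then show ?thesis using assms(2,3)
  proof (induction X)
    case empty
    show ?case by (simp add: card_components_empty)
  next
    case (insert e X)
    then obtain x y where xy: "x \<in> V" "y \<in> V" "r e = {x, y}"
      by (auto simp: edges_on_def)
    moreover have "insert e X - {e} = X" using insert(2) by simp
    ultimately have "(x, y) \<notin> reach r X"
      using insert.prems(2) unfolding forest_def by fastforce
    moreover have "forest r X" using insert.prems(2) by (rule forest_subset) auto
    ultimately show ?case
      using card_components_insert[where X = X and r = r, OF assms(1) xy] insert
      by (auto simp: edges_on_def)
  qed
qed

lemma card_components_eq_1_iff:
  assumes "finite V" "V \<noteq> {}"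
  shows "card (V // reach r X) = 1 \<longleftrightarrow> V \<times> V \<subseteq> reach r X"
proof
  assume "card (V // reach r X) = 1"
  then obtain C where C: "V // reach r X = {C}" by (auto simp: card_1_singleton_iff)
  show "V \<times> V \<subseteq> reach r X"
  proof clarify
    fix u v assume "u \<in> V" "v \<in> V"
    then have "reach r X `` {u} \<in> {C}" "reach r X `` {v} \<in> {C}"
      unfolding C[symmetric] by (auto intro: quotientI)
    then have "reach r X `` {u} = reach r X `` {v}" by simp
    moreover have "v \<in> reach r X `` {v}" by simp
    ultimately have "v \<in> reach r X `` {u}" by (simp only:)
    then show "(u, v) \<in> reach r X" by simp
  qed
next
  assume *: "V \<times> V \<subseteq> reach r X"
  obtain u where u: "u \<in> V" using assms(2) by auto
  have "reach r X `` {v} = reach r X `` {u}" if "v \<in> V" for v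
    using equiv_class_eq[OF equiv_reach, of v u r X] * u that by blast
  then have "(\<lambda>v. reach r X `` {v}) ` V = {reach r X `` {u}}"
    using u by blast
  moreover have "V // reach r X = (\<lambda>v. reach r X `` {v}) ` V"
    by (auto simp: quotient_def)
  ultimately have "V // reach r X = {reach r X `` {u}}"
    by simp
  then show "card (V // reach r X) = 1" by simp
qed

lemma connected_card_le:
  assumes "finite V" "V \<noteq> {}" "edges_on V r X" "V \<times> V \<subseteq> reach r X"
  shows "card V \<le> card X + 1"
  using card_le_components_plus_edges[OF assms(1,3)] card_components_eq_1_iff[OF assms(1,2)] assms(4)
  by (metis add.commute)

lemma card_components_pos:
  assumes "finite V" "V \<noteq> {}"
  shows "card (V // reach r X) \<ge> 1"
proof -
  have "finite (V // reach r X)" "V // reach r X \<noteq> {}"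
    using assms by (auto simp: quotient_def)
  then show ?thesis by (simp add: Suc_leI card_gt_0_iff)
qed

section \<open>Cycles and bridges\<close>

fun simple_path :: "('e \<Rightarrow> 'v set) \<Rightarrow> 'e set \<Rightarrow> 'v list \<Rightarrow> 'e list \<Rightarrow> bool" where
  "simple_path r X [v] [] \<longleftrightarrow> True"
| "simple_path r X (u # v # vs) (e # es) \<longleftrightarrow>
     e \<in> X \<and> r e = {u, v} \<and> u \<notin> set (v # vs) \<and> simple_path r X (v # vs) es"
| "simple_path r X _ _ \<longleftrightarrow> False"

lemma simple_path_props:
  assumes "simple_path r X vs es"
  shows "length vs = Suc (length es) \<and> distinct vs \<and> distinct es \<and> set es \<subseteq> X \<and>
    (\<forall>e\<in>set es. r e \<subseteq> set vs) \<and> (\<forall>i<length es. r (es ! i) = {vs ! i, vs ! Suc i})"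
  using assms
proof (induction r X vs es rule: simple_path.induct)
  case (2 r X u v vs e es)
  then show ?case
    by (auto simp: nth_Cons split: nat.splits)
qed auto

lemma simple_path_suffix:
  assumes "simple_path r X vs es" "u \<in> set vs"
  shows "\<exists>vs' es'. simple_path r X vs' es' \<and> hd vs' = u \<and> last vs' = last vs"
  using assms
proof (induction r X vs es rule: simple_path.induct)
  case (1 r X v)
  then show ?case by (intro exI[of _ "[v]"] exI[of _ "[]"]) auto
next
  case (2 r X w v vs e es)
  show ?case
  proof (cases "u = w")
    case True
    then show ?thesis
      using "2.prems" by (intro exI[of _ "w # v # vs"] exI[of _ "e # es"]) auto
  next
    case False
    then show ?thesis using 2 by auto
  qed
qed auto

text \<open>
  When a new first vertex already lies on the path, the path is cut down to its suffix from there.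
\<close>

lemma reach_imp_simple_path:
  assumes "(u, v) \<in> reach r X"
  shows "\<exists>vs es. simple_path r X vs es \<and> hd vs = u \<and> last vs = v"
  using assms[unfolded reach_def]
proof (induction rule: converse_rtrancl_induct)
  case base
  show ?case by (intro exI[of _ "[v]"] exI[of _ "[]"]) auto
next
  case (step u w)
  then obtain e vs es where e: "e \<in> X" "r e = {u, w}"
    and p: "simple_path r X vs es" "hd vs = w" "last vs = v"
    by auto
  show ?case
  proof (cases "u \<in> set vs")
    case True
    then show ?thesis using simple_path_suffix[OF p(1)] p(3) by auto
  next
    case False
    obtain ws where ws: "vs = w # ws"
      using p(1,2) by (cases vs) auto
    then show ?thesis
      using e p False by (intro exI[of _ "u # vs"] exI[of _ "e # es"]) auto
  qed
qed

text \<open>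
  An edge that is not a bridge closes a simple path between its endpoints to a cycle, and
  conversely the last edge of a cycle is bypassed by the others. Self-loops fit in as edges that
  close a path of length \<open>0\<close>.
\<close>

lemma acyclic_iff_forest:
  assumes "edges_on (verts G) (ends G) (edges G)"
  shows "(\<nexists>vs es. is_cycle G vs es) \<longleftrightarrow> forest (ends G) (edges G)"
proof
  assume acyc: "\<nexists>vs es. is_cycle G vs es"
  show "forest (ends G) (edges G)"
    unfolding forest_def
  proof (intro ballI allI impI notI)
    fix e x y
    assume e: "e \<in> edges G" "ends G e = {x, y}"
      and "(x, y) \<in> reach (ends G) (edges G - {e})"
    then obtain vs es where p: "simple_path (ends G) (edges G - {e}) vs es" "hd vs = x" "last vs = y"
      using reach_imp_simple_path by metis
    note props = simple_path_props[OF p(1)]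
    have len: "length vs = Suc (length es)" using props by simp
    then have ne: "vs \<noteq> []" by auto
    have nth: "ends G ((es @ [e]) ! i) = {vs ! i, vs ! (Suc i mod length vs)}"
      if "i < length (es @ [e])" for i
    proof (cases "i < length es")
      case True
      then show ?thesis using props by (simp add: nth_append)
    next
      case False
      then have "i = length es" using that by simp
      then show ?thesis
        using e(2) p len ne by (simp add: hd_conv_nth last_conv_nth insert_commute)
    qed
    have "set vs \<subseteq> verts G"
    proof
      fix v assume "v \<in> set vs"
      then obtain i where i: "i < length (es @ [e])" "v = vs ! i"
        using len by (metis in_set_conv_nth length_append_singleton)
      have "(es @ [e]) ! i \<in> edges G"
        using nth_mem[OF i(1)] e(1) props by auto
      then have "ends G ((es @ [e]) ! i) \<subseteq> verts G"
        using assms unfolding edges_on_def by (metis empty_subsetI insert_subset)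
      then show "v \<in> verts G" using nth[OF i(1)] i(2) by auto
    qed
    then have "is_cycle G vs (es @ [e])"
      unfolding is_cycle_def using props e(1) nth by auto
    then show False using acyc by blast
  qed
next
  assume f: "forest (ends G) (edges G)"
  show "\<nexists>vs es. is_cycle G vs es"
  proof clarify
    fix vs es assume "is_cycle G vs es"
    then have c: "es \<noteq> []" "length vs = length es" "distinct es" "set es \<subseteq> edges G"
      "\<And>i. i < length es \<Longrightarrow> ends G (es ! i) = {vs ! i, vs ! (Suc i mod length vs)}"
      by (auto simp: is_cycle_def)
    define n where "n = length es - 1"
    have n: "length es = Suc n" using c(1) by (simp add: n_def)
    have "i \<le> n \<Longrightarrow> (vs ! 0, vs ! i) \<in> reach (ends G) (edges G - {es ! n})" for i
    proof (induction i)
      case (Suc i)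
      have "es ! i \<noteq> es ! n" "es ! i \<in> edges G"
        using Suc.prems c(3,4) n by (auto simp: nth_eq_iff_index_eq)
      moreover have "ends G (es ! i) = {vs ! i, vs ! Suc i}"
        using Suc.prems c(2) c(5)[of i] n by simp
      ultimately have "(vs ! i, vs ! Suc i) \<in> reach (ends G) (edges G - {es ! n})"
        by (intro reach_edge) auto
      then show ?case using Suc by (auto intro: reach_trans)
    qed simp
    moreover have "ends G (es ! n) = {vs ! 0, vs ! n}" "es ! n \<in> edges G"
      using c(2,4) c(5)[of n] n by (auto simp: insert_commute)
    ultimately show False using f unfolding forest_def by blast
  qed
qed

section \<open>Spanning trees and edge exchange\<close>

lemma finite_mgraph_edges_on:
  assumes "finite_mgraph G" "X \<subseteq> edges G"
  shows "edges_on (verts G) (ends G) X"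
  unfolding edges_on_def
proof (intro conjI ballI)
  show "finite X" using assms by (auto simp: finite_mgraph_def intro: finite_subset)
  fix e assume "e \<in> X"
  then have "ends G e \<subseteq> verts G" "card (ends G e) = 1 \<or> card (ends G e) = 2"
    using assms by (auto simp: finite_mgraph_def)
  then show "\<exists>x\<in>verts G. \<exists>y\<in>verts G. ends G e = {x, y}"
    by (auto simp: card_1_singleton_iff card_2_iff)
qed

lemma spanning_trees_iff:
  assumes "finite_mgraph G" "verts G \<noteq> {}"
  shows "T \<in> spanning_trees G \<longleftrightarrow> T \<subseteq> edges G \<and>
    verts G \<times> verts G \<subseteq> reach (ends G) T \<and> forest (ends G) T"
  using acyclic_iff_forest[of "G\<lparr>edges := T\<rparr>"] finite_mgraph_edges_on[OF assms(1)] assms(2)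
  by (auto simp: spanning_trees_def is_tree_def mconnected_iff_reach)

text \<open>
  A connected graph on \<open>n\<close> vertices has at least \<open>n - 1\<close> edges. With exactly \<open>n - 1\<close>, no edge can be
  deleted without losing connectedness, so every edge is a bridge.
\<close>

lemma spanning_trees_iff_card:
  assumes G: "finite_mgraph G" "verts G \<noteq> {}"
  shows "T \<in> spanning_trees G \<longleftrightarrow> T \<subseteq> edges G \<and>
    verts G \<times> verts G \<subseteq> reach (ends G) T \<and> card T + 1 = card (verts G)"
proof -
  have fin: "finite (verts G)" using G by (simp add: finite_mgraph_def)
  have "forest (ends G) T \<longleftrightarrow> card T + 1 = card (verts G)"
    if T: "T \<subseteq> edges G" and conn: "verts G \<times> verts G \<subseteq> reach (ends G) T"
  proof
    assume "forest (ends G) T"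
    from forest_card_components[OF fin finite_mgraph_edges_on[OF G(1) T] this]
    show "card T + 1 = card (verts G)"
      using card_components_eq_1_iff[OF fin G(2)] conn by (metis add.commute)
  next
    assume c: "card T + 1 = card (verts G)"
    show "forest (ends G) T"
      unfolding forest_def
    proof (intro ballI allI impI notI)
      fix e x y assume e: "e \<in> T" "ends G e = {x, y}" "(x, y) \<in> reach (ends G) (T - {e})"
      have "reach (ends G) (T - {e}) = reach (ends G) T"
        using reach_insert_redundant[OF e(2,3)] e(1) by (simp add: insert_absorb)
      then have "card (verts G) \<le> card (T - {e}) + 1"
        using connected_card_le[OF fin G(2) finite_mgraph_edges_on[OF G(1), of "T - {e}"]] T conn
        by auto
      moreover have "finite T" using finite_mgraph_edges_on[OF G(1) T] by (simp add: edges_on_def)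
      ultimately show False using c e(1) using card_Suc_Diff1[of T e] by simp
    qed
  qed
  then show ?thesis using spanning_trees_iff[OF G] by blast
qed

text \<open>
  The path in \<open>T\<close> between the endpoints of \<open>f\<close> uses an edge \<open>g\<close> outside \<open>F\<close>, and \<open>f\<close> together with the
  rest of that path replaces \<open>g\<close>. Connectedness is preserved and so is the number of edges, and
  these two properties characterise spanning trees.
\<close>

lemma tree_exchange:
  assumes G: "finite_mgraph G" "verts G \<noteq> {}" and T: "T \<in> spanning_trees G"
    and f: "f \<in> edges G" "ends G f = {u, v}" "f \<notin> T"
    and F: "(u, v) \<notin> reach (ends G) (T \<inter> F)"
  shows "\<exists>g\<in>T - F. insert f (T - {g}) \<in> spanning_trees G"
proof -
  let ?r = "ends G"
  have TE: "T \<subseteq> edges G" and conn: "verts G \<times> verts G \<subseteq> reach ?r T"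
    and card: "card T + 1 = card (verts G)"
    using T spanning_trees_iff_card[OF G] by auto
  have fin: "finite T" using TE G by (auto simp: finite_mgraph_def intro: finite_subset)
  have uv: "u \<in> verts G" "v \<in> verts G" using G(1) f by (auto simp: finite_mgraph_def)
  (* A minimal set of tree edges connecting u and v plays the part of the path, and by minimality
     the deletion of any of its edges separates u from v within it. *)
  define P where "P = {X. X \<subseteq> T \<and> (u, v) \<in> reach ?r X}"
  have "finite P" "T \<in> P" using fin conn uv by (auto simp: P_def)
  then obtain X where X: "X \<in> P" and min: "\<And>Y. Y \<in> P \<Longrightarrow> Y \<subseteq> X \<Longrightarrow> Y = X"
    using finite_has_minimal2[of P T] by blast
  have XT: "X \<subseteq> T" "(u, v) \<in> reach ?r X" using X by (auto simp: P_def)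
  have "\<not> X \<subseteq> F"
    using F XT reach_mono[of X "T \<inter> F" ?r] by auto
  then obtain g where g: "g \<in> X" "g \<notin> F" by auto
  obtain x y where xy: "?r g = {x, y}"
    using finite_mgraph_edges_on[OF G(1) TE] g(1) XT(1) unfolding edges_on_def by blast
  have "(u, v) \<notin> reach ?r (X - {g})"
    using min[of "X - {g}"] g(1) XT(1) by (auto simp: P_def)
  moreover have "insert g (X - {g}) = X" using g(1) by auto
  ultimately have "(u, x) \<in> reach ?r (X - {g}) \<and> (y, v) \<in> reach ?r (X - {g}) \<or>
      (u, y) \<in> reach ?r (X - {g}) \<and> (x, v) \<in> reach ?r (X - {g})"
    using reach_insert[of ?r g x y u v "X - {g}"] xy XT(2) by auto
  moreover have "reach ?r (X - {g}) \<subseteq> reach ?r (insert f (T - {g}))"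
    using XT(1) by (intro reach_mono) auto
  ultimately have "(u, x) \<in> reach ?r (insert f (T - {g})) \<and> (y, v) \<in> reach ?r (insert f (T - {g})) \<or>
      (u, y) \<in> reach ?r (insert f (T - {g})) \<and> (x, v) \<in> reach ?r (insert f (T - {g}))"
    by auto
  moreover have "(u, v) \<in> reach ?r (insert f (T - {g}))"
    using f(2) by (intro reach_edge) auto
  ultimately have joined: "(x, y) \<in> reach ?r (insert f (T - {g}))"
    by (metis reach_trans reach_sym)
  have "reach ?r T \<subseteq> reach ?r (insert f (T - {g}))"
  proof (rule reach_least)
    fix e a b assume e: "e \<in> T" "?r e = {a, b}"
    show "(a, b) \<in> reach ?r (insert f (T - {g}))"
    proof (cases "e = g")
      case True
      then show ?thesis using e(2) xy joined by (auto simp: doubleton_eq_iff intro: reach_sym)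
    next
      case False
      then show ?thesis using e by (intro reach_edge[of e]) auto
    qed
  qed
  moreover have "card (insert f (T - {g})) = card T"
    using fin f(3) card_Suc_Diff1[of T g] g(1) XT(1) by auto
  ultimately have "insert f (T - {g}) \<in> spanning_trees G"
    using spanning_trees_iff_card[OF G] TE f(1) conn card by auto
  then show ?thesis using g XT(1) by blast
qed

section \<open>Optimality of a pmf on spanning trees\<close>

lemma finite_spanning_trees:
  assumes "finite_mgraph G"
  shows "finite (spanning_trees G)"
  using assms by (auto simp: spanning_trees_def finite_mgraph_def intro: finite_subset[of _ "Pow (edges G)"])

lemma sum_pmf_spanning_trees:
  assumes "finite_mgraph G" "\<mu> \<in> tree_pmfs G"
  shows "(\<Sum>\<gamma>\<in>spanning_trees G. pmf \<mu> \<gamma>) = 1"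
  using assms finite_spanning_trees by (auto simp: tree_pmfs_def intro: sum_pmf_eq_1)

text \<open>
  Linearity of expectation: both sides are the expected \<open>w\<close>-weight of the part in \<open>A\<close> of a random
  spanning tree.
\<close>

lemma sum_weighted_edge_usage:
  assumes "finite_mgraph G" "A \<subseteq> edges G"
  shows "(\<Sum>e\<in>A. w e * edge_usage G \<mu> e) = (\<Sum>\<gamma>\<in>spanning_trees G. pmf \<mu> \<gamma> * (\<Sum>e\<in>\<gamma> \<inter> A. w e))"
proof -
  have fA: "finite A" using assms by (auto simp: finite_mgraph_def intro: finite_subset)
  note fS = finite_spanning_trees[OF assms(1)]
  have "(\<Sum>e\<in>A. w e * edge_usage G \<mu> e) =
      (\<Sum>e\<in>A. \<Sum>\<gamma>\<in>spanning_trees G. if e \<in> \<gamma> then pmf \<mu> \<gamma> * w e else 0)"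
    unfolding edge_usage_def sum_distrib_left
    by (simp add: sum.inter_filter[OF fS, symmetric] mult.commute)
  also have "\<dots> = (\<Sum>\<gamma>\<in>spanning_trees G. \<Sum>e\<in>A. if e \<in> \<gamma> then pmf \<mu> \<gamma> * w e else 0)"
    by (rule sum.swap)
  also have "\<dots> = (\<Sum>\<gamma>\<in>spanning_trees G. pmf \<mu> \<gamma> * (\<Sum>e\<in>\<gamma> \<inter> A. w e))"
  proof (intro sum.cong refl)
    fix \<gamma>
    have "{e \<in> A. e \<in> \<gamma>} = \<gamma> \<inter> A" by auto
    then show "(\<Sum>e\<in>A. if e \<in> \<gamma> then pmf \<mu> \<gamma> * w e else 0) = pmf \<mu> \<gamma> * (\<Sum>e\<in>\<gamma> \<inter> A. w e)"
      using sum.inter_filter[OF fA, of "\<lambda>e. pmf \<mu> \<gamma> * w e" "\<lambda>e. e \<in> \<gamma>"]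
      by (simp add: sum_distrib_left)
  qed
  finally show ?thesis .
qed

lemma sum_edge_usage:
  assumes "finite_mgraph G" "A \<subseteq> edges G"
  shows "(\<Sum>e\<in>A. edge_usage G \<mu> e) = (\<Sum>\<gamma>\<in>spanning_trees G. pmf \<mu> \<gamma> * real (card (\<gamma> \<inter> A)))"
  using sum_weighted_edge_usage[OF assms, of "\<lambda>_. 1"] by simp

lemma expected_overlap_eq_sum_squares:
  assumes "finite_mgraph G"
  shows "expected_overlap G \<mu> = (\<Sum>e\<in>edges G. (edge_usage G \<mu> e)\<^sup>2)"
proof -
  let ?S = "spanning_trees G"
  have sub: "\<gamma> \<inter> edges G = \<gamma>" if "\<gamma> \<in> ?S" for \<gamma>
    using that by (auto simp: spanning_trees_def)
  have inner: "(\<Sum>\<gamma>'\<in>?S. real (card (\<gamma> \<inter> \<gamma>')) * pmf \<mu> \<gamma> * pmf \<mu> \<gamma>') =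
      pmf \<mu> \<gamma> * (\<Sum>e\<in>\<gamma> \<inter> edges G. edge_usage G \<mu> e)" if "\<gamma> \<in> ?S" for \<gamma>
    using sum_edge_usage[OF assms, of \<gamma> \<mu>] sub[OF that]
    by (simp add: le_iff_inf sum_distrib_left Int_commute mult_ac)
  have "expected_overlap G \<mu> = (\<Sum>\<gamma>\<in>?S. pmf \<mu> \<gamma> * (\<Sum>e\<in>\<gamma> \<inter> edges G. edge_usage G \<mu> e))"
    unfolding expected_overlap_def using inner by (intro sum.cong) auto
  also have "\<dots> = (\<Sum>e\<in>edges G. edge_usage G \<mu> e * edge_usage G \<mu> e)"
    using sum_weighted_edge_usage[OF assms subset_refl, of "edge_usage G \<mu>" \<mu>] by simp
  finally show ?thesis by (simp add: power2_eq_square)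
qed

lemma average_attained_on_support:
  fixes f :: "'a \<Rightarrow> real"
  assumes "finite S" "(\<Sum>x\<in>S. p x) = 1" "\<And>x. x \<in> S \<Longrightarrow> p x \<ge> 0"
    and "\<And>x. x \<in> S \<Longrightarrow> f x \<le> m" "(\<Sum>x\<in>S. p x * f x) \<ge> m"
    and "x \<in> S" "p x > 0"
  shows "f x = m"
proof -
  have nonneg: "p y * (m - f y) \<ge> 0" if "y \<in> S" for y
    using assms(3,4)[OF that] by simp
  have "(\<Sum>y\<in>S. p y * (m - f y)) = m - (\<Sum>y\<in>S. p y * f y)"
    using assms(2) by (simp add: right_diff_distrib sum_subtractf flip: sum_distrib_right)
  then have "(\<Sum>y\<in>S. p y * (m - f y)) = 0"
    using assms(5) sum_nonneg[of S "\<lambda>y. p y * (m - f y)"] nonneg by auto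
  then have "p x * (m - f x) = 0"
    using sum_nonneg_eq_0_iff[OF assms(1), of "\<lambda>y. p y * (m - f y)"] nonneg assms(6) by auto
  then show ?thesis using assms(7) by simp
qed

text \<open>
  Mixing \<open>\<mu>\<close> with the point mass at \<open>T\<close> moves the usage from \<open>\<eta>\<close> along a segment towards the indicator
  of \<open>T\<close>. The derivative of the sum of squares at \<open>\<mu>\<close> in this direction cannot be negative, and it is
  twice the difference of the two sides.
\<close>

lemma optimal_first_order:
  assumes G: "finite_mgraph G" and opt: "optimal_pmf G \<mu>" and T: "T \<in> spanning_trees G"
  shows "(\<Sum>e\<in>edges G. (edge_usage G \<mu> e)\<^sup>2) \<le> (\<Sum>e\<in>T. edge_usage G \<mu> e)"
proof -
  let ?\<eta> = "edge_usage G \<mu>"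
  let ?x = "\<lambda>e. if e \<in> T then 1 else 0 :: real"
  define B where "B = (\<Sum>e\<in>edges G. ?\<eta> e * (?x e - ?\<eta> e))"
  define C where "C = (\<Sum>e\<in>edges G. (?x e - ?\<eta> e)\<^sup>2)"
  note fS = finite_spanning_trees[OF G]
  have step: "0 \<le> 2 * B + t * C" if t: "0 < t" "t < 1" for t
  proof -
    define \<nu> where "\<nu> = bind_pmf (bernoulli_pmf t) (\<lambda>b. if b then return_pmf T else \<mu>)"
    have \<nu>: "pmf \<nu> \<gamma> = t * (if \<gamma> = T then 1 else 0) + (1 - t) * pmf \<mu> \<gamma>" for \<gamma>
      using t by (auto simp: \<nu>_def pmf_bind)
    have "\<nu> \<in> tree_pmfs G"
      using opt T by (auto simp: \<nu>_def optimal_pmf_def tree_pmfs_def split: if_splits)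
    then have "expected_overlap G \<mu> \<le> expected_overlap G \<nu>"
      using opt by (simp add: optimal_pmf_def)
    moreover have "edge_usage G \<nu> e = ?\<eta> e + t * (?x e - ?\<eta> e)" for e
    proof -
      have "(\<Sum>\<gamma> | \<gamma> \<in> spanning_trees G \<and> e \<in> \<gamma>. if \<gamma> = T then 1 else 0 :: real) = ?x e"
        using fS T by (subst sum.delta) auto
      then have "edge_usage G \<nu> e = t * ?x e + (1 - t) * ?\<eta> e"
        unfolding edge_usage_def \<nu> by (simp only: sum.distrib flip: sum_distrib_left)
      then show ?thesis by (simp add: algebra_simps)
    qed
    ultimately have "(\<Sum>e\<in>edges G. (?\<eta> e)\<^sup>2) \<le> (\<Sum>e\<in>edges G. (?\<eta> e + t * (?x e - ?\<eta> e))\<^sup>2)"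
      by (simp add: expected_overlap_eq_sum_squares[OF G])
    also have "\<dots> = (\<Sum>e\<in>edges G. (?\<eta> e)\<^sup>2) + t * (2 * B + t * C)"
      unfolding B_def C_def distrib_left sum_distrib_left sum.distrib[symmetric]
      by (intro sum.cong refl) (simp add: power2_eq_square algebra_simps)
    finally show ?thesis using t(1) by (simp add: zero_le_mult_iff)
  qed
  have "0 \<le> B"
  proof (rule ccontr)
    assume "\<not> 0 \<le> B"
    then have B: "B < 0" by simp
    have C: "C \<ge> 0" by (simp add: C_def sum_nonneg)
    (* A step so short that the quadratic term is at most half of the linear decrease; the 1 in the
       denominator keeps t positive for C = 0. *)
    define t where "t = min (1/2) (- B / (C + 1))"
    have "0 < t" "t < 1" using B C by (auto simp: t_def divide_neg_pos)
    moreover have "t * C \<le> - B"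
    proof -
      have "t * C \<le> t * (C + 1)" using \<open>0 < t\<close> by simp
      also have "\<dots> \<le> - B / (C + 1) * (C + 1)"
        using C by (intro mult_right_mono) (auto simp: t_def)
      finally show ?thesis using C by simp
    qed
    ultimately show False using step[of t] B by linarith
  qed
  moreover have "B = (\<Sum>e\<in>T. ?\<eta> e) - (\<Sum>e\<in>edges G. (?\<eta> e)\<^sup>2)"
  proof -
    have "(\<Sum>e\<in>edges G. ?\<eta> e * ?x e) = (\<Sum>e\<in>edges G. if e \<in> T then ?\<eta> e else 0)"
      by (intro sum.cong) auto
    also have "\<dots> = (\<Sum>e\<in>edges G \<inter> T. ?\<eta> e)"
      using G by (simp add: sum.inter_restrict finite_mgraph_def)
    also have "edges G \<inter> T = T" using T by (auto simp: spanning_trees_def)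
    finally show ?thesis
      by (simp add: B_def right_diff_distrib sum_subtractf power2_eq_square)
  qed
  ultimately show ?thesis by simp
qed

text \<open>
  The usage weight averages to \<open>\<Sum>e. (\<eta> e)\<^sup>2\<close> over the random tree, and by \<open>optimal_first_order\<close> no tree
  is lighter. So every tree of positive mass attains this minimum.
\<close>

lemma fair_tree_min_usage:
  assumes G: "finite_mgraph G" and opt: "optimal_pmf G \<mu>"
    and \<gamma>: "\<gamma> \<in> spanning_trees G" "pmf \<mu> \<gamma> > 0" and T: "T \<in> spanning_trees G"
  shows "(\<Sum>e\<in>\<gamma>. edge_usage G \<mu> e) \<le> (\<Sum>e\<in>T. edge_usage G \<mu> e)"
proof -
  let ?m = "\<Sum>e\<in>edges G. (edge_usage G \<mu> e)\<^sup>2"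
  have sub: "\<gamma> \<inter> edges G = \<gamma>" if "\<gamma> \<in> spanning_trees G" for \<gamma>
    using that by (auto simp: spanning_trees_def)
  have "?m = (\<Sum>\<gamma>\<in>spanning_trees G. pmf \<mu> \<gamma> * (\<Sum>e\<in>\<gamma>. edge_usage G \<mu> e))"
    using sum_weighted_edge_usage[OF G subset_refl, of "edge_usage G \<mu>" \<mu>]
    by (simp add: power2_eq_square sub cong: sum.cong)
  then have "(\<Sum>\<gamma>\<in>spanning_trees G. pmf \<mu> \<gamma> * - (\<Sum>e\<in>\<gamma>. edge_usage G \<mu> e)) \<ge> - ?m"
    by (simp add: sum_negf)
  moreover have "(\<Sum>\<gamma>\<in>spanning_trees G. pmf \<mu> \<gamma>) = 1"
    using opt by (simp add: optimal_pmf_def sum_pmf_spanning_trees[OF G])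
  ultimately have "- (\<Sum>e\<in>\<gamma>. edge_usage G \<mu> e) = - ?m"
    using average_attained_on_support[OF finite_spanning_trees[OF G], where p = "pmf \<mu>"
        and f = "\<lambda>\<gamma>. - (\<Sum>e\<in>\<gamma>. edge_usage G \<mu> e)" and m = "- ?m", OF _ pmf_nonneg _ _ \<gamma>]
      optimal_first_order[OF G opt] by simp
  then show ?thesis using optimal_first_order[OF G opt T] by simp
qed

text \<open>
  Otherwise an edge of usage \<open>a\<close> could be exchanged for a tree edge of larger usage, and the tree
  would become lighter, against \<open>fair_tree_min_usage\<close>.
\<close>

lemma fair_tree_joins_least_used:
  assumes G: "finite_mgraph G" "verts G \<noteq> {}" and opt: "optimal_pmf G \<mu>"
    and \<gamma>: "\<gamma> \<in> spanning_trees G" "pmf \<mu> \<gamma> > 0"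
    and a: "\<And>e. e \<in> edges G \<Longrightarrow> a \<le> edge_usage G \<mu> e"
  defines "F \<equiv> {e \<in> edges G. edge_usage G \<mu> e = a}"
  shows "reach (ends G) (\<gamma> \<inter> F) = reach (ends G) F"
proof
  show "reach (ends G) (\<gamma> \<inter> F) \<subseteq> reach (ends G) F" by (intro reach_mono) auto
  show "reach (ends G) F \<subseteq> reach (ends G) (\<gamma> \<inter> F)"
  proof (rule reach_least, rule ccontr)
    fix f u v assume f: "f \<in> F" "ends G f = {u, v}" and no: "(u, v) \<notin> reach (ends G) (\<gamma> \<inter> F)"
    have fin: "finite \<gamma>" and sub: "\<gamma> \<subseteq> edges G"
      using \<gamma>(1) G(1) by (auto simp: spanning_trees_def finite_mgraph_def intro: finite_subset)
    have "f \<notin> \<gamma>" using no f by (auto intro: reach_edge)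
    moreover have "f \<in> edges G" using f(1) by (simp add: F_def)
    ultimately obtain g where g: "g \<in> \<gamma>" "g \<notin> F" "insert f (\<gamma> - {g}) \<in> spanning_trees G"
      using tree_exchange[OF G \<gamma>(1) _ f(2) _ no] by blast
    have "edge_usage G \<mu> g > a" using a[of g] g sub by (force simp: F_def)
    moreover have "(\<Sum>e\<in>\<gamma>. edge_usage G \<mu> e) \<le> (\<Sum>e\<in>insert f (\<gamma> - {g}). edge_usage G \<mu> e)"
      by (rule fair_tree_min_usage[OF G(1) opt \<gamma> g(3)])
    moreover have "(\<Sum>e\<in>insert f (\<gamma> - {g}). edge_usage G \<mu> e) = a + (\<Sum>e\<in>\<gamma>. edge_usage G \<mu> e) - edge_usage G \<mu> g"
      using fin \<open>f \<notin> \<gamma>\<close> f(1) g(1) by (simp add: F_def sum_diff1)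
    ultimately show False by simp
  qed
qed

section \<open>The usage is at least the inverse of the maximal denseness\<close>

lemma edge_ends_ne:
  assumes "finite_mgraph G" "loopless G" "e \<in> edges G"
  obtains x y where "ends G e = {x, y}" "x \<noteq> y" "x \<in> verts G" "y \<in> verts G"
proof -
  have "card (ends G e) = 2" "ends G e \<subseteq> verts G"
    using assms by (auto simp: finite_mgraph_def loopless_def)
  then show ?thesis using that by (auto simp: card_2_iff)
qed

text \<open>
  The bound is first obtained for an edge of least usage \<open>a\<close>, by counting in two ways the tree edges
  inside its component \<open>C\<close> of the graph of least used edges: a fair tree has at least \<open>|C| - 1\<close> of
  them, while on average there are \<open>a\<close> times the number of least used edges in \<open>C\<close>, of which the
  hypothesis allows at most \<open>D (|C| - 1)\<close>.
\<close>

lemma edge_usage_lower_bound: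
  assumes G: "finite_mgraph G" "mconnected G" "loopless G" and opt: "optimal_pmf G \<mu>"
    and D: "\<And>H. H \<in> induced_connected_subgraphs G \<Longrightarrow>
      real (card (edges H)) \<le> D * (real (card (verts H)) - 1)"
    and e: "e \<in> edges G"
  shows "1 \<le> D * edge_usage G \<mu> e"
proof -
  let ?r = "ends G" and ?\<eta> = "edge_usage G \<mu>"
  define a where "a = Min (?\<eta> ` edges G)"
  have ne: "verts G \<noteq> {}" using G(2) by (simp add: mconnected_def)
  have fin: "finite (edges G)" "finite (verts G)" using G(1) by (auto simp: finite_mgraph_def)
  have a: "a \<le> ?\<eta> e" if "e \<in> edges G" for e using fin that by (simp add: a_def)
  have "a \<in> ?\<eta> ` edges G" unfolding a_def using fin e by (intro Min_in) auto
  then obtain f where f: "f \<in> edges G" "?\<eta> f = a" by auto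
  have a0: "0 \<le> a" using f by (auto simp: edge_usage_def sum_nonneg)
  define F where "F = {e \<in> edges G. ?\<eta> e = a}"
  obtain x y where xy: "?r f = {x, y}" "x \<noteq> y" "x \<in> verts G" "y \<in> verts G"
    using edge_ends_ne[OF G(1,3) f(1)] by blast
  define C where "C = reach ?r F `` {x}"
  define EC where "EC = {e \<in> F. ?r e \<subseteq> C}"
  define K where "K = G\<lparr>verts := C, edges := {e \<in> edges G. ?r e \<subseteq> C}\<rparr>"
  have FG: "F \<subseteq> edges G" by (auto simp: F_def)
  have xyC: "x \<in> C" "y \<in> C"
    using f xy(1) by (auto simp: C_def F_def intro!: reach_edge)
  have CV: "C \<subseteq> verts G"
  proof
    fix v assume "v \<in> C"
    then have "(x, v) \<in> {(u, v). \<exists>e\<in>F. ?r e = {u, v}}\<^sup>*" by (simp add: C_def reach_def)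
    then show "v \<in> verts G"
    proof (induction rule: rtrancl_induct)
      case (step v w)
      then obtain e where "e \<in> edges G" "?r e = {v, w}" using FG by auto
      then show ?case using G(1) by (auto simp: finite_mgraph_def)
    qed (rule xy(3))
  qed
  have finC: "finite C" using CV fin(2) by (rule finite_subset)
  have "card {x, y} \<le> card C" using xyC finC by (intro card_mono) auto
  then have C2: "real (card C) - 1 > 0" using xy(2) by simp
  have connected_by: "C \<times> C \<subseteq> reach ?r {e \<in> X. ?r e \<subseteq> C}"
    if X: "reach ?r X = reach ?r F" for X
  proof clarify
    fix u v assume "u \<in> C" "v \<in> C"
    then have "(x, u) \<in> reach ?r {e \<in> X. ?r e \<subseteq> C}" "(x, v) \<in> reach ?r {e \<in> X. ?r e \<subseteq> C}"
      using reach_within_component[of x _ ?r X] by (auto simp: C_def X)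
    then show "(u, v) \<in> reach ?r {e \<in> X. ?r e \<subseteq> C}" by (meson reach_trans reach_sym)
  qed
  have "K \<in> induced_connected_subgraphs G"
  proof -
    have "reach ?r EC \<subseteq> reach ?r {e \<in> edges G. ?r e \<subseteq> C}"
      using FG by (intro reach_mono) (auto simp: EC_def)
    then have "mconnected K"
      using connected_by[OF refl] xyC by (auto simp: mconnected_iff_reach K_def EC_def)
    moreover have "f \<in> edges K" using f xy(1) xyC by (auto simp: K_def)
    ultimately show ?thesis
      using CV by (auto simp: induced_connected_subgraphs_def vertex_induced_def subgraph_def K_def)
  qed
  then have "real (card (edges K)) \<le> D * (real (card C) - 1)"
    using D[of K] by (simp add: K_def)
  moreover have "card EC \<le> card (edges K)"
    using fin FG by (intro card_mono) (auto simp: EC_def K_def)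
  ultimately have upper: "real (card EC) \<le> D * (real (card C) - 1)" by linarith
  have "real (card C) - 1 \<le> real (card (\<gamma> \<inter> EC))"
    if \<gamma>: "\<gamma> \<in> spanning_trees G" "pmf \<mu> \<gamma> > 0" for \<gamma>
  proof -
    have "{e \<in> \<gamma> \<inter> F. ?r e \<subseteq> C} = \<gamma> \<inter> EC" by (auto simp: EC_def)
    then have "C \<times> C \<subseteq> reach ?r (\<gamma> \<inter> EC)"
      using connected_by[of "\<gamma> \<inter> F"] fair_tree_joins_least_used[OF G(1) ne opt \<gamma> a]
      by (simp add: F_def)
    moreover have "edges_on C ?r (\<gamma> \<inter> EC)"
    proof -
      have "\<gamma> \<inter> EC \<subseteq> edges G" using FG by (auto simp: EC_def)
      then have "edges_on (verts G) ?r (\<gamma> \<inter> EC)" by (rule finite_mgraph_edges_on[OF G(1)])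
      then show ?thesis by (rule edges_on_within) (simp add: EC_def)
    qed
    ultimately have "card C \<le> card (\<gamma> \<inter> EC) + 1"
      using connected_card_le[OF finC] xyC by blast
    then show ?thesis by linarith
  qed
  then have "pmf \<mu> \<gamma> * (real (card C) - 1) \<le> pmf \<mu> \<gamma> * real (card (\<gamma> \<inter> EC))"
    if "\<gamma> \<in> spanning_trees G" for \<gamma>
    using that by (cases "pmf \<mu> \<gamma> = 0") (auto intro!: mult_left_mono simp: order_less_le)
  then have "(\<Sum>\<gamma>\<in>spanning_trees G. pmf \<mu> \<gamma> * (real (card C) - 1)) \<le>
      (\<Sum>\<gamma>\<in>spanning_trees G. pmf \<mu> \<gamma> * real (card (\<gamma> \<inter> EC)))"
    by (rule sum_mono)
  also have "\<dots> = (\<Sum>e\<in>EC. ?\<eta> e)"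
    using sum_edge_usage[OF G(1), of EC \<mu>] FG by (simp add: EC_def subset_iff)
  also have "\<dots> = a * real (card EC)"
    by (simp add: EC_def F_def)
  also have "\<dots> \<le> a * (D * (real (card C) - 1))"
    using upper a0 by (rule mult_left_mono)
  finally have "real (card C) - 1 \<le> (a * D) * (real (card C) - 1)"
    using sum_pmf_spanning_trees[OF G(1)] opt
    by (simp add: optimal_pmf_def mult.assoc flip: sum_distrib_right)
  then have "1 \<le> a * D" using C2 by simp
  moreover have "0 \<le> D"
    using upper C2 by (smt (verit) of_nat_0_le_iff zero_le_mult_iff)
  ultimately show ?thesis
    using mult_right_mono[OF a[OF e], of D] by (simp add: mult.commute)
qed

section \<open>Densest subgraphs\<close>

lemma finite_induced_connected_subgraphs:
  assumes "finite_mgraph G"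
  shows "finite (induced_connected_subgraphs G)"
proof (rule finite_surj)
  show "finite (Pow (verts G) \<times> Pow (edges G))" using assms by (simp add: finite_mgraph_def)
  show "induced_connected_subgraphs G \<subseteq>
      (\<lambda>(A, B). G\<lparr>verts := A, edges := B\<rparr>) ` (Pow (verts G) \<times> Pow (edges G))"
  proof
    fix H assume "H \<in> induced_connected_subgraphs G"
    then have "verts H \<subseteq> verts G" "edges H \<subseteq> edges G" "ends H = ends G"
      by (auto simp: induced_connected_subgraphs_def vertex_induced_def subgraph_def)
    then show "H \<in> (\<lambda>(A, B). G\<lparr>verts := A, edges := B\<rparr>) ` (Pow (verts G) \<times> Pow (edges G))"
      by (intro image_eqI[of _ _ "(verts H, edges H)"]) auto
  qed
qed

lemma induced_connected_subgraphs_trans: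
  assumes "H \<in> induced_connected_subgraphs G" "K \<in> induced_connected_subgraphs H"
  shows "K \<in> induced_connected_subgraphs G"
proof -
  have H: "verts H \<subseteq> verts G" "edges H \<subseteq> edges G" "ends H = ends G"
      "\<And>e. e \<in> edges G \<Longrightarrow> ends G e \<subseteq> verts H \<Longrightarrow> e \<in> edges H"
    and K: "verts K \<subseteq> verts H" "edges K \<subseteq> edges H" "ends K = ends H" "mconnected K" "edges K \<noteq> {}"
      "\<And>e. e \<in> edges K \<Longrightarrow> ends K e \<subseteq> verts K"
      "\<And>e. e \<in> edges H \<Longrightarrow> ends H e \<subseteq> verts K \<Longrightarrow> e \<in> edges K"
    using assms unfolding induced_connected_subgraphs_def vertex_induced_def subgraph_def by blast+
  have "e \<in> edges K" if "e \<in> edges G" "ends G e \<subseteq> verts K" for e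
    using that H(3) by (intro K(7) H(4)) (auto dest: subsetD[OF K(1)])
  moreover have "verts K \<subseteq> verts G" "edges K \<subseteq> edges G" "ends K = ends G"
    using H(1-3) K(1-3) by simp_all
  ultimately show ?thesis
    using K(4-6) by (simp add: induced_connected_subgraphs_def vertex_induced_def subgraph_def)
qed

lemma subgraph_wellformed:
  assumes "finite_mgraph G" "loopless G" "subgraph H G"
  shows "finite_mgraph H" "loopless H"
  using assms by (simp_all add: finite_mgraph_def loopless_def subgraph_def subset_iff)
    (auto intro: finite_subset)

lemma card_verts_ge_2:
  assumes "finite_mgraph G" "loopless G" "edges G \<noteq> {}"
  shows "card (verts G) \<ge> 2"
proof -
  obtain e where "e \<in> edges G" using assms(3) by auto
  then obtain x y where "x \<noteq> y" "x \<in> verts G" "y \<in> verts G"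
    using edge_ends_ne[OF assms(1,2)] by metis
  then show ?thesis
    using assms(1) card_mono[of "verts G" "{x, y}"] by (simp add: finite_mgraph_def)
qed

lemma card_edges_eq_denseness:
  assumes "finite_mgraph G" "loopless G" "edges G \<noteq> {}"
  shows "real (card (edges G)) = denseness G * (real (card (verts G)) - 1)"
  using card_verts_ge_2[OF assms] by (simp add: denseness_def)

text \<open>
  The trace of a tree is a forest in \<open>H\<close>, so its number of edges and its number of components add up
  to \<open>|V\<^sub>H|\<close>.
\<close>

lemma tree_trace_on_subgraph:
  assumes G: "finite_mgraph G" "loopless G" and H: "subgraph H G" "verts H \<noteq> {}"
    and \<gamma>: "\<gamma> \<in> spanning_trees G"
  shows "card (\<gamma> \<inter> edges H) + 1 \<le> card (verts H)"
    and "card (\<gamma> \<inter> edges H) + 1 = card (verts H) \<Longrightarrow> \<gamma> \<inter> edges H \<in> spanning_trees H"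
proof -
  have finH: "finite_mgraph H" and ends: "ends H = ends G" and ne: "verts G \<noteq> {}"
    using subgraph_wellformed[OF G H(1)] H by (auto simp: subgraph_def)
  have fin: "finite (verts H)" using finH by (simp add: finite_mgraph_def)
  have "forest (ends G) \<gamma>" using \<gamma> spanning_trees_iff[OF G(1) ne] by simp
  then have forest: "forest (ends H) (\<gamma> \<inter> edges H)"
    unfolding ends by (rule forest_subset) auto
  have cnt: "card (verts H) = card (verts H // reach (ends H) (\<gamma> \<inter> edges H)) + card (\<gamma> \<inter> edges H)"
    by (rule forest_card_components[OF fin finite_mgraph_edges_on[OF finH] forest]) auto
  then show "card (\<gamma> \<inter> edges H) + 1 \<le> card (verts H)"
    using card_components_pos[OF fin H(2), of "ends H" "\<gamma> \<inter> edges H"] by simp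
  assume "card (\<gamma> \<inter> edges H) + 1 = card (verts H)"
  then have "verts H \<times> verts H \<subseteq> reach (ends H) (\<gamma> \<inter> edges H)"
    using cnt card_components_eq_1_iff[OF fin H(2), of "ends H" "\<gamma> \<inter> edges H"] by simp
  then show "\<gamma> \<inter> edges H \<in> spanning_trees H"
    using spanning_trees_iff[OF finH H(2)] forest by simp
qed

lemma edge_usage_ge_inverse_denseness:
  assumes G: "finite_mgraph G" "mconnected G" "loopless G"
    and max: "\<And>K. K \<in> induced_connected_subgraphs G \<Longrightarrow> denseness K \<le> d"
    and opt: "optimal_pmf G \<mu>" and e: "e \<in> edges G"
  shows "1 \<le> d * edge_usage G \<mu> e"
proof (rule edge_usage_lower_bound[OF G opt _ e])
  fix K assume K: "K \<in> induced_connected_subgraphs G"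
  then have sub: "subgraph K G" and ne: "edges K \<noteq> {}"
    by (auto simp: induced_connected_subgraphs_def vertex_induced_def)
  note wf = subgraph_wellformed[OF G(1,3) sub]
  show "real (card (edges K)) \<le> d * (real (card (verts K)) - 1)"
    unfolding card_edges_eq_denseness[OF wf ne]
    using max[OF K] card_verts_ge_2[OF wf ne] by (intro mult_right_mono) auto
qed

text \<open>
  By the lower bound on the usage, the trace of a random tree on \<open>H\<close> has on average at least
  \<open>|E\<^sub>H| / denseness H = |V\<^sub>H| - 1\<close> edges. This is also the largest possible number, hence it is
  attained by every fair tree.
\<close>

lemma fair_tree_spans_densest:
  assumes G: "finite_mgraph G" "mconnected G" "loopless G"
    and H: "H \<in> induced_connected_subgraphs G"
    and max: "\<And>K. K \<in> induced_connected_subgraphs G \<Longrightarrow> denseness K \<le> denseness H"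
    and fair: "fair_tree G \<gamma>"
  shows "\<gamma> \<inter> edges H \<in> spanning_trees H"
proof -
  obtain \<mu> where \<gamma>: "\<gamma> \<in> spanning_trees G" "pmf \<mu> \<gamma> > 0" and opt: "optimal_pmf G \<mu>"
    using fair by (auto simp: fair_tree_def)
  have sub: "subgraph H G" and ne: "edges H \<noteq> {}" "verts H \<noteq> {}"
    using H by (auto simp: induced_connected_subgraphs_def vertex_induced_def mconnected_def)
  then have HG: "edges H \<subseteq> edges G" by (simp add: subgraph_def)
  note wf = subgraph_wellformed[OF G(1,3) sub]
  note trace = tree_trace_on_subgraph[OF G(1,3) sub ne(2)]
  have pos: "denseness H > 0"
    using ne card_verts_ge_2[OF wf ne(1)] wf(1)
    by (simp add: denseness_def finite_mgraph_def card_gt_0_iff)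
  have "denseness H * (real (card (verts H)) - 1) = (\<Sum>e\<in>edges H. 1)"
    using card_edges_eq_denseness[OF wf ne(1)] by simp
  also have "\<dots> \<le> (\<Sum>e\<in>edges H. denseness H * edge_usage G \<mu> e)"
    using HG edge_usage_ge_inverse_denseness[OF G max opt] by (intro sum_mono) auto
  finally have "real (card (verts H)) - 1 \<le> (\<Sum>e\<in>edges H. edge_usage G \<mu> e)"
    using pos by (simp flip: sum_distrib_left)
  then have "real (card (verts H)) - 1 \<le>
      (\<Sum>\<gamma>\<in>spanning_trees G. pmf \<mu> \<gamma> * real (card (\<gamma> \<inter> edges H)))"
    by (simp add: sum_edge_usage[OF G(1) HG])
  moreover have "real (card (\<gamma> \<inter> edges H)) \<le> real (card (verts H)) - 1"
    if "\<gamma> \<in> spanning_trees G" for \<gamma>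
    using trace(1)[OF that] by linarith
  moreover have "(\<Sum>\<gamma>\<in>spanning_trees G. pmf \<mu> \<gamma>) = 1"
    using opt by (simp add: optimal_pmf_def sum_pmf_spanning_trees[OF G(1)])
  ultimately have "real (card (\<gamma> \<inter> edges H)) = real (card (verts H)) - 1"
    using average_attained_on_support[OF finite_spanning_trees[OF G(1)], where p = "pmf \<mu>"
        and f = "\<lambda>\<gamma>. real (card (\<gamma> \<inter> edges H))", OF _ pmf_nonneg _ _ \<gamma>] by simp
  then have "card (\<gamma> \<inter> edges H) + 1 = card (verts H)" by linarith
  then show ?thesis by (rule trace(2)[OF \<gamma>(1)])
qed

text \<open>
  The usages of a graph sum to \<open>|V| - 1 = |E| / denseness G\<close>, so when each of them is at least
  \<open>1 / denseness G\<close> there is no room for a larger one.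
\<close>

lemma edge_usage_eq_inverse_denseness:
  assumes G: "finite_mgraph G" "mconnected G" "loopless G"
    and max: "\<And>K. K \<in> induced_connected_subgraphs G \<Longrightarrow> denseness K \<le> denseness G"
    and opt: "optimal_pmf G \<mu>" and e: "e \<in> edges G"
  shows "denseness G * edge_usage G \<mu> e = 1"
proof -
  have ne: "verts G \<noteq> {}" "edges G \<noteq> {}" using G(2) e by (auto simp: mconnected_def)
  have fin: "finite (edges G)" using G(1) by (simp add: finite_mgraph_def)
  have "real (card (\<gamma> \<inter> edges G)) = real (card (verts G)) - 1" if "\<gamma> \<in> spanning_trees G" for \<gamma>
  proof -
    have "\<gamma> \<inter> edges G = \<gamma>" "card \<gamma> + 1 = card (verts G)"
      using that spanning_trees_iff_card[OF G(1) ne(1)] by auto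
    then show ?thesis by simp
  qed
  then have "(\<Sum>e\<in>edges G. edge_usage G \<mu> e) = real (card (verts G)) - 1"
    using sum_pmf_spanning_trees[OF G(1), of \<mu>] opt
    by (simp add: sum_edge_usage[OF G(1) subset_refl] optimal_pmf_def flip: sum_distrib_right)
  then have "(\<Sum>e\<in>edges G. denseness G * edge_usage G \<mu> e - 1) = 0"
    using card_edges_eq_denseness[OF G(1,3) ne(2)]
    by (simp add: sum_subtractf flip: sum_distrib_left)
  moreover have "denseness G * edge_usage G \<mu> e - 1 \<ge> 0" if "e \<in> edges G" for e
    using edge_usage_ge_inverse_denseness[OF G max opt that] by simp
  ultimately have "denseness G * edge_usage G \<mu> e - 1 = 0"
    using fin e by (simp add: sum_nonneg_eq_0_iff)
  then show ?thesis by simp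
qed

text \<open>
  Every optimal pmf uses every edge with probability \<open>1 / denseness G\<close>. So the predicates that
  \<open>opt_edge_usage\<close> describes for the various edges coincide, and with them the described values.
\<close>

lemma homogeneous_if_densest:
  assumes G: "finite_mgraph G" "mconnected G" "loopless G"
    and max: "\<And>K. K \<in> induced_connected_subgraphs G \<Longrightarrow> denseness K \<le> denseness G"
  shows "homogeneous G"
proof -
  have "edge_usage G \<mu> e = 1 / denseness G" if "optimal_pmf G \<mu>" "e \<in> edges G" for \<mu> e
    using edge_usage_eq_inverse_denseness[OF G max that]
    by (metis mult_zero_left nonzero_eq_divide_eq mult.commute zero_neq_one)
  then have "(\<exists>\<mu>. optimal_pmf G \<mu> \<and> x = edge_usage G \<mu> e) \<longleftrightarrow>
      (\<exists>\<mu>. optimal_pmf G \<mu> \<and> x = 1 / denseness G)" if "e \<in> edges G" for x e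
    using that by auto
  then have "opt_edge_usage G e = (THE x. \<exists>\<mu>. optimal_pmf G \<mu> \<and> x = 1 / denseness G)"
    if "e \<in> edges G" for e
    using that by (simp add: opt_edge_usage_def)
  then show ?thesis by (auto simp: homogeneous_def)
qed

theorem theorem5p9:
  fixes G H :: "('v, 'e) mgraph"
  assumes "finite_mgraph G" and "mconnected G" and "loopless G" and "edges G \<noteq> {}"
    and "H \<in> induced_connected_subgraphs G"
    and "denseness H = Max (denseness ` induced_connected_subgraphs G)"
  shows "homogeneous_core H G"
proof -
  have max: "denseness K \<le> denseness H" if "K \<in> induced_connected_subgraphs G" for K
    using that finite_induced_connected_subgraphs[OF assms(1)] by (simp add: assms(6))
  have H: "vertex_induced H G" "subgraph H G" "mconnected H" "edges H \<noteq> {}"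
    using assms(5) by (auto simp: induced_connected_subgraphs_def vertex_induced_def)
  have "homogeneous H"
    using subgraph_wellformed[OF assms(1,3) H(2)] H(3)
      max[OF induced_connected_subgraphs_trans[OF assms(5)]]
    by (intro homogeneous_if_densest) auto
  then show ?thesis
    using H fair_tree_spans_densest[OF assms(1-3,5) max] by (auto simp: homogeneous_core_def)
qed

end
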